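(* Let $n\ge1$, let $p_1,p_2\ge1$ and $0<p<\infty$ satisfy $\frac1{p_1}+\frac1{p_2}=1+\frac1p$, and let $0\le\sigma,\sigma_1,\sigma_2<\infty$ satisfy $\sigma_1p_1p_1'=\sigma_2p_2p_2'$ and $\sigma p=\sigma_1p_1+\sigma_2p_2$. Define $\widetilde u$ in terms of $u_1,u_2:\mathbb{R}_+\times\mathbb{R}^n\to\mathbb{R}_+$ by $$\widetilde u^{1/p}=u_1^{1/p_1}*u_2^{1/p_2},$$ where the convolution is taken in the spatial variable in $\mathbb{R}^n$, and where $u_1,u_2$ satisfy the technical regularity hypotheses in the context. Then: (1) If $\partial_tu_j\ge\sigma_j\Delta u_j$ for $j=1,2$, then $\partial_t\widetilde u\ge\sigma\Delta\widetilde u$. (2) If $\sigma_1,\sigma_2>0$ and $D^2(\log u_j)\ge-\frac{I}{2\sigma_jt}$ for $j=1,2$, then $D^2(\log\widetilde u)\ge-\frac{I}{2\sigma t}$. Here $I$ denotes the identity on $\mathbb{R}^n$.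
   Context: $\mathbb{R}_+=(0,\infty)$. Functions $u(t,x)$ have time variable $t\in\mathbb{R}_+$ and space variable $x\in\mathbb{R}^n$; $\Delta$ and the Hessian $D^2$ act in $x$ only. Matrix inequalities $P\ge Q$ mean that $P-Q$ is positive semidefinite, and inequalities are required or asserted at every point $(t,x)$. For $q\ge1$, $q'$ denotes the dual exponent, $\frac1q+\frac1{q'}=1$; the condition $\sigma_1p_1p_1'=\sigma_2p_2p_2'$ is understood as $\frac{\sigma_1p_1}{p_2'}=\frac{\sigma_2p_2}{p_1'}$ with $\frac1{p_j'}=1-\frac1{p_j}$ (which also makes sense when some $p_j=1$). Technical regularity hypotheses on $u_1,u_2$: they are once continuously differentiable in $t$ and twice continuously differentiable in $x$; the convolution $f_1*f_2$ of $f_j:=u_j^{1/p_j}$ is finite everywhere and is once continuously differentiable in $t$ and twice continuously differentiable in $x$; its derivatives may be computed by differentiating under the integral sign, namely $\partial_t(f_1*f_2)=(\partial_tf_1)*f_2+f_1*(\partial_tf_2)$, $\partial_i(f_1*f_2)=(\partial_if_1)*f_2=f_1*(\partial_if_2)$ and $\partial_{ij}(f_1*f_2)=(\partial_{ij}f_1)*f_2=(\partial_if_1)*(\partial_jf_2)=f_1*(\partial_{ij}f_2)$; and all of these integrals, as well as those obtained by expanding the derivatives of $f_j$ in terms of $u_j$, its $t$-derivative, and first and second space derivatives of $u_j$ and of $\log u_j$ (for instance $(f_1\,\partial_i(\log u_1)\,\partial_j(\log u_1))*f_2$, $(f_1\,\partial_{ij}(\log u_1))*f_2$, $(f_1\,\tfrac{\partial_tu_1}{u_1})*f_2$,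 and the same with the roles of $1$ and $2$ exchanged), converge absolutely. *)

theory Defs
  imports "HOL-Analysis.Analysis"
begin

text \<open>
  A function on \<open>\<real>\<^sub>+ \<times> \<real>\<^sup>n\<close> with \<open>\<real>\<^sub>+ = (0,\<infinity>)\<close> is represented by \<open>u :: real \<Rightarrow> real^'n \<Rightarrow> real\<close>;
  only its values at times \<open>t > 0\<close> are ever used.
\<close>

definition dt :: "(real \<Rightarrow> real^'n \<Rightarrow> real) \<Rightarrow> real \<Rightarrow> real^'n \<Rightarrow> real" where
  "dt u t x = deriv (\<lambda>s. u s x) t"

definition dx :: "'n::finite \<Rightarrow> (real^'n \<Rightarrow> real) \<Rightarrow> real^'n \<Rightarrow> real" where
  "dx i f x = frechet_derivative f (at x) (axis i 1)"

definition laplacian :: "(real^'n::finite \<Rightarrow> real) \<Rightarrow> real^'n \<Rightarrow> real" where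
  "laplacian f x = (\<Sum>i\<in>UNIV. dx i (dx i f) x)"

definition hessian :: "(real^'n::finite \<Rightarrow> real) \<Rightarrow> real^'n \<Rightarrow> real^'n^'n" where
  "hessian f x = (\<chi> i j. dx i (dx j f) x)"

definition pos_semidef :: "real^'n^'n::finite \<Rightarrow> bool" where
  "pos_semidef A \<longleftrightarrow> transpose A = A \<and> (\<forall>v. 0 \<le> v \<bullet> (A *v v))"

definition matrix_ge :: "real^'n^'n::finite \<Rightarrow> real^'n^'n \<Rightarrow> bool" where
  "matrix_ge P Q \<longleftrightarrow> pos_semidef (P - Q)"

text \<open>
  Differentiability of the first partial derivatives gives their continuity, so the following is
  twice continuous differentiability on the whole space.
\<close>

definition C2 :: "(real^'n::finite \<Rightarrow> real) \<Rightarrow> bool" where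
  "C2 f \<longleftrightarrow> f differentiable_on UNIV \<and> (\<forall>i. dx i f differentiable_on UNIV) \<and>
    (\<forall>i j. continuous_on UNIV (dx i (dx j f)))"

text \<open>
  Once continuously differentiable in \<open>t\<close> for each \<open>x\<close>, twice continuously differentiable in \<open>x\<close>
  for each \<open>t\<close>; joint continuity of the derivatives in \<open>(t, x)\<close> is not demanded.
\<close>

definition C12 :: "(real \<Rightarrow> real^'n::finite \<Rightarrow> real) \<Rightarrow> bool" where
  "C12 u \<longleftrightarrow> (\<forall>x. (\<lambda>t. u t x) C1_differentiable_on {0<..}) \<and> (\<forall>t>0. C2 (u t))"

definition conv :: "(real^'n::finite \<Rightarrow> real) \<Rightarrow> (real^'n \<Rightarrow> real) \<Rightarrow> real^'n \<Rightarrow> real" where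
  "conv f g x = (\<integral>y. f (x - y) * g y \<partial>lborel)"

definition conv_converges ::
  "(real^'n::finite \<Rightarrow> real) \<Rightarrow> (real^'n \<Rightarrow> real) \<Rightarrow> real^'n \<Rightarrow> bool" where
  "conv_converges f g x \<longleftrightarrow> integrable lborel (\<lambda>y. f (x - y) * g y)"

definition root_fun :: "real \<Rightarrow> (real \<Rightarrow> real^'n \<Rightarrow> real) \<Rightarrow> real \<Rightarrow> real^'n \<Rightarrow> real" where
  "root_fun p u t x = u t x powr (1 / p)"

text \<open>The function \<open>w\<close> determined by \<open>w\<^bsup>1/p\<^esup> = u\<^sub>1\<^bsup>1/p\<^sub>1\<^esup> * u\<^sub>2\<^bsup>1/p\<^sub>2\<^esup>\<close>.\<close>

definition u_tilde :: "real \<Rightarrow> real \<Rightarrow> real \<Rightarrow> (real \<Rightarrow> real^'n::finite \<Rightarrow> real) \<Rightarrow>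
    (real \<Rightarrow> real^'n \<Rightarrow> real) \<Rightarrow> real \<Rightarrow> real^'n \<Rightarrow> real" where
  "u_tilde p p1 p2 u1 u2 t x = conv (root_fun p1 u1 t) (root_fun p2 u2 t) x powr p"

definition diff_under_integral ::
  "(real \<Rightarrow> real^'n::finite \<Rightarrow> real) \<Rightarrow> (real \<Rightarrow> real^'n \<Rightarrow> real) \<Rightarrow> bool" where
  "diff_under_integral f1 f2 \<longleftrightarrow> (\<forall>t>0. \<forall>x.
     dt (\<lambda>s. conv (f1 s) (f2 s)) t x = conv (dt f1 t) (f2 t) x + conv (f1 t) (dt f2 t) x \<and>
     (\<forall>i. dx i (conv (f1 t) (f2 t)) x = conv (dx i (f1 t)) (f2 t) x \<and>
          dx i (conv (f1 t) (f2 t)) x = conv (f1 t) (dx i (f2 t)) x) \<and>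
     (\<forall>i j. dx i (dx j (conv (f1 t) (f2 t))) x = conv (dx i (dx j (f1 t))) (f2 t) x \<and>
            dx i (dx j (conv (f1 t) (f2 t))) x = conv (dx i (f1 t)) (dx j (f2 t)) x \<and>
            dx i (dx j (conv (f1 t) (f2 t))) x = conv (f1 t) (dx i (dx j (f2 t))) x))"

definition derivative_integrals_converge ::
  "(real \<Rightarrow> real^'n::finite \<Rightarrow> real) \<Rightarrow> (real \<Rightarrow> real^'n \<Rightarrow> real) \<Rightarrow> bool" where
  "derivative_integrals_converge f1 f2 \<longleftrightarrow> (\<forall>t>0. \<forall>x.
     conv_converges (dt f1 t) (f2 t) x \<and> conv_converges (f1 t) (dt f2 t) x \<and>
     (\<forall>i. conv_converges (dx i (f1 t)) (f2 t) x \<and> conv_converges (f1 t) (dx i (f2 t)) x) \<and>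
     (\<forall>i j. conv_converges (dx i (dx j (f1 t))) (f2 t) x \<and>
            conv_converges (dx i (f1 t)) (dx j (f2 t)) x \<and>
            conv_converges (f1 t) (dx i (dx j (f2 t))) x))"

text \<open>
  With \<open>f = u\<^bsup>1/p\<^esup>\<close>, the derivatives \<open>\<partial>\<^sub>t f\<close>, \<open>\<partial>\<^sub>i f\<close>, \<open>\<partial>\<^sub>i\<partial>\<^sub>j f\<close> are linear combinations of products
  \<open>f \<cdot> h\<close>, where \<open>h\<close> is one of the functions below; \<open>\<partial>\<^sub>i u / u = \<partial>\<^sub>i (log u)\<close> needs no separate entry.
\<close>

definition expansion_factors ::
  "(real \<Rightarrow> real^'n::finite \<Rightarrow> real) \<Rightarrow> real \<Rightarrow> (real^'n \<Rightarrow> real) set" where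
  "expansion_factors u t =
     {\<lambda>x. dt u t x / u t x} \<union>
     {dx i (\<lambda>x. ln (u t x)) | i. True} \<union>
     {\<lambda>x. dx i (\<lambda>x. ln (u t x)) x * dx j (\<lambda>x. ln (u t x)) x | i j. True} \<union>
     {dx i (dx j (\<lambda>x. ln (u t x))) | i j. True} \<union>
     {\<lambda>x. dx i (dx j (u t)) x / u t x | i j. True}"

definition expanded_integrals_converge :: "real \<Rightarrow> real \<Rightarrow>
    (real \<Rightarrow> real^'n::finite \<Rightarrow> real) \<Rightarrow> (real \<Rightarrow> real^'n \<Rightarrow> real) \<Rightarrow> bool" where
  "expanded_integrals_converge p1 p2 u1 u2 \<longleftrightarrow> (\<forall>t>0. \<forall>x.
     (\<forall>h \<in> expansion_factors u1 t.
        conv_converges (\<lambda>y. root_fun p1 u1 t y * h y) (root_fun p2 u2 t) x) \<and>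
     (\<forall>h \<in> expansion_factors u2 t.
        conv_converges (root_fun p1 u1 t) (\<lambda>y. root_fun p2 u2 t y * h y) x) \<and>
     (\<forall>i j. conv_converges (\<lambda>y. root_fun p1 u1 t y * dx i (\<lambda>z. ln (u1 t z)) y)
                           (\<lambda>y. root_fun p2 u2 t y * dx j (\<lambda>z. ln (u2 t z)) y) x))"

definition technical_regularity :: "real \<Rightarrow> real \<Rightarrow>
    (real \<Rightarrow> real^'n::finite \<Rightarrow> real) \<Rightarrow> (real \<Rightarrow> real^'n \<Rightarrow> real) \<Rightarrow> bool" where
  "technical_regularity p1 p2 u1 u2 \<longleftrightarrow>
     C12 u1 \<and> C12 u2 \<and>
     (\<forall>t>0. \<forall>x. conv_converges (root_fun p1 u1 t) (root_fun p2 u2 t) x) \<and>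
     C12 (\<lambda>t. conv (root_fun p1 u1 t) (root_fun p2 u2 t)) \<and>
     diff_under_integral (root_fun p1 u1) (root_fun p2 u2) \<and>
     derivative_integrals_converge (root_fun p1 u1) (root_fun p2 u2) \<and>
     expanded_integrals_converge p1 p2 u1 u2"

end

theory Submission
  imports Defs
begin

text \<open>
  Write \<open>f\<^sub>j = u\<^sub>j\<^bsup>1/p\<^sub>j\<^esup>\<close> and \<open>F = f\<^sub>1 * f\<^sub>2\<close>, so that \<open>F\<^sup>p\<close> is the function under study. Fix \<open>(t, x)\<close> and
  let \<open>E\<close> be the expectation for the probability density \<open>f\<^sub>1(x - y) f\<^sub>2(y) / F(x)\<close> in \<open>y\<close>. With the
  random vectors \<open>X = \<nabla> log f\<^sub>1(x - y)\<close> and \<open>Y = \<nabla> log f\<^sub>2(y)\<close>, the freedom to let each derivative of the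
  convolution fall on either factor reads

  \<open>\<nabla>F / F = E X = E Y\<close>,

  \<open>D\<^sup>2F / F = E [D\<^sup>2 log f\<^sub>1 + X X\<^sup>T] = E [X Y\<^sup>T] = E [D\<^sup>2 log f\<^sub>2 + Y Y\<^sup>T]\<close>.

  So the expectation of a quadratic form in \<open>(X, Y)\<close> can be expressed through \<open>D\<^sup>2F\<close> and the expected
  Hessians of \<open>log f\<^sub>j\<close>, and if the form is positive semidefinite, then Jensen's inequality bounds
  this expectation below by the value of the form at the common mean \<open>(\<nabla>F / F, \<nabla>F / F)\<close>. Both parts
  are instances of this, for two different forms.

  For the heat inequality, dividing \<open>\<partial>\<^sub>t u\<^sub>j \<ge> \<sigma>\<^sub>j \<Delta> u\<^sub>j\<close> by \<open>u\<^sub>j\<close> bounds \<open>\<partial>\<^sub>t F / F\<close> below by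
  \<open>E [\<sigma>\<^sub>1 (\<Delta> log f\<^sub>1 + p\<^sub>1 |X|\<^sup>2) + \<sigma>\<^sub>2 (\<Delta> log f\<^sub>2 + p\<^sub>2 |Y|\<^sup>2)]\<close>, while the claim is
  \<open>\<partial>\<^sub>t F / F \<ge> \<sigma> (\<Delta>F / F + (p - 1) |\<nabla>F / F|\<^sup>2)\<close>. Elimination of the Hessians leaves, in each
  coordinate, Jensen's inequality for the form with diagonal coefficients \<open>\<sigma>\<^sub>1 (p\<^sub>1 - 1)\<close> and
  \<open>\<sigma>\<^sub>2 (p\<^sub>2 - 1)\<close> and off-diagonal coefficient \<open>(\<sigma>\<^sub>1 + \<sigma>\<^sub>2 - \<sigma>) / 2\<close>. The relations between the exponents
  and the diffusivities make this form a square whose value at \<open>(1, 1)\<close> is \<open>\<sigma> (p - 1)\<close>; see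
  \<open>heat_coordinate\<close>.

  For the Hessian bound, let \<open>X\<close> and \<open>Y\<close> be components in a direction \<open>\<xi>\<close> and use the form
  \<open>(\<theta> X + \<mu> Y)\<^sup>2\<close> with \<open>\<theta> + \<mu> = 1\<close>. The hypotheses bound \<open>E X\<^sup>2\<close> and \<open>E Y\<^sup>2\<close> above by the second
  derivative of \<open>F\<close> in direction \<open>\<xi>\<close>, divided by \<open>F\<close>, plus a constant, which gives
  \<open>directional_hessian_bound\<close>; the weights \<open>\<theta>\<close> and \<open>\<mu>\<close> proportional to \<open>\<sigma>\<^sub>1 p\<^sub>1\<close> and \<open>\<sigma>\<^sub>2 p\<^sub>2\<close> produce the
  constant asserted.
\<close>

section \<open>Partial derivatives of powers and logarithms\<close>

lemma dx_eqI:
  assumes "(f has_derivative f') (at x)"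
  shows "dx i f x = f' (axis i 1)"
  using frechet_derivative_at[OF assms] by (simp add: dx_def)

lemma has_derivative_frechet:
  "f differentiable (at x) \<Longrightarrow> (f has_derivative frechet_derivative f (at x)) (at x)"
  by (simp add: frechet_derivative_works)

lemma dx_mult:
  assumes "f differentiable (at x)" "g differentiable (at x)"
  shows "dx i (\<lambda>y. f y * g y) x = f x * dx i g x + dx i f x * g x"
proof -
  have "((\<lambda>y. f y * g y) has_derivative
      (\<lambda>h. f x * frechet_derivative g (at x) h + frechet_derivative f (at x) h * g x)) (at x)"
    by (intro has_derivative_mult has_derivative_frechet assms)
  from dx_eqI[OF this] show ?thesis by (simp add: dx_def)
qed

lemma dx_cmult:
  assumes "f differentiable (at x)"
  shows "dx i (\<lambda>y. c * f y) x = c * dx i f x"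
  using dx_mult[of "\<lambda>_. c", OF _ assms] by (simp add: dx_def)

lemma dx_chain:
  fixes \<phi> :: "real \<Rightarrow> real"
  assumes "f differentiable (at x)" "(\<phi> has_real_derivative d) (at (f x))"
  shows "dx i (\<lambda>y. \<phi> (f y)) x = d * dx i f x"
proof -
  have "((\<lambda>y. \<phi> (f y)) has_derivative (\<lambda>h. frechet_derivative f (at x) h * d)) (at x)"
    by (rule DERIV_compose_FDERIV[OF assms(2) has_derivative_frechet[OF assms(1)]])
  from dx_eqI[OF this] show ?thesis by (simp add: dx_def mult.commute)
qed

lemma C2_differentiable:
  assumes "C2 f"
  shows "f differentiable (at x)" "dx i f differentiable (at x)"
  using assms by (auto simp: C2_def differentiable_on_def)

lemma DERIV_powr_base:
  fixes r :: real
  assumes "r > 0"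
  shows "((\<lambda>r. r powr q) has_real_derivative r powr q * (q / r)) (at r)"
  using has_real_derivative_powr[OF assms, of q] assms
  by (simp add: powr_diff mult.commute mult.left_commute)

context
  fixes u :: "real^'n::finite \<Rightarrow> real"
  assumes u_pos: "\<And>x. u x > 0" and u_C2: "C2 u"
begin

lemma dx_ln: "dx i (\<lambda>y. ln (u y)) = (\<lambda>x. dx i u x / u x)"
proof
  fix x
  show "dx i (\<lambda>y. ln (u y)) x = dx i u x / u x"
    using dx_chain[OF C2_differentiable(1)[OF u_C2] DERIV_ln[OF u_pos[of x]], of i]
    by (simp add: divide_inverse mult.commute)
qed

lemma differentiable_ln: "(\<lambda>y. ln (u y)) differentiable (at x)"
proof -
  have "((\<lambda>y. ln (u y)) has_derivative (\<lambda>h. frechet_derivative u (at x) h * inverse (u x))) (at x)"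
    by (rule DERIV_compose_FDERIV[OF DERIV_ln[OF u_pos]
          has_derivative_frechet[OF C2_differentiable(1)[OF u_C2]]])
  then show ?thesis by (rule differentiableI)
qed

lemma differentiable_dx_ln: "dx i (\<lambda>y. ln (u y)) differentiable (at x)"
  unfolding dx_ln using u_pos[of x] C2_differentiable[OF u_C2]
  by (intro differentiable_divide) auto

text \<open>
  Derivatives of powers are written as the power times a polynomial in derivatives of the logarithm,
  which turns derivatives of a convolution of powers into averages of such polynomials.
\<close>

lemma dx_powr:
  "dx i (\<lambda>y. u y powr q) = (\<lambda>x. u x powr q * (q * dx i (\<lambda>y. ln (u y)) x))"
proof
  fix x
  show "dx i (\<lambda>y. u y powr q) x = u x powr q * (q * dx i (\<lambda>y. ln (u y)) x)"
    using dx_chain[OF C2_differentiable(1)[OF u_C2] DERIV_powr_base[OF u_pos[of x], of q], of i]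
    by (simp add: dx_ln)
qed

lemma differentiable_powr: "(\<lambda>y. u y powr q) differentiable (at x)"
proof -
  have "((\<lambda>y. u y powr q) has_derivative
      (\<lambda>h. frechet_derivative u (at x) h * (u x powr q * (q / u x)))) (at x)"
    by (rule DERIV_compose_FDERIV[OF DERIV_powr_base[OF u_pos]
          has_derivative_frechet[OF C2_differentiable(1)[OF u_C2]]])
  then show ?thesis by (rule differentiableI)
qed

lemma dx_dx_powr:
  "dx i (dx j (\<lambda>y. u y powr q)) x = u x powr q *
     (q * dx i (dx j (\<lambda>y. ln (u y))) x
      + (q * dx i (\<lambda>y. ln (u y)) x) * (q * dx j (\<lambda>y. ln (u y)) x))"
proof -
  have "(\<lambda>x. q * dx j (\<lambda>y. ln (u y)) x) differentiable (at x)"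
    by (intro differentiable_mult differentiable_const differentiable_dx_ln)
  from dx_mult[OF differentiable_powr[of q x] this, of i]
  show ?thesis
    by (simp add: dx_powr dx_cmult differentiable_dx_ln algebra_simps)
qed

text \<open>The case \<open>q = 1\<close> of the preceding formula, solved for the Hessian of the logarithm.\<close>

lemma dx_dx_ln:
  "dx i (dx j (\<lambda>y. ln (u y))) x
     = dx i (dx j u) x / u x - dx i (\<lambda>y. ln (u y)) x * dx j (\<lambda>y. ln (u y)) x"
  using dx_dx_powr[of i j 1 x] u_pos by (simp add: less_imp_le field_simps less_imp_neq[symmetric])

lemma dx_dx_ln_powr:
  "dx i (dx j (\<lambda>y. ln (u y powr q))) x = q * dx i (dx j (\<lambda>y. ln (u y))) x"
proof -
  have "(\<lambda>y. ln (u y powr q)) = (\<lambda>y. q * ln (u y))"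
    using u_pos by (auto simp: ln_powr less_imp_neq[symmetric])
  moreover have "dx j (\<lambda>y. q * ln (u y)) = (\<lambda>x. q * dx j (\<lambda>y. ln (u y)) x)"
    by (rule ext) (rule dx_cmult[OF differentiable_ln])
  ultimately show ?thesis by (simp add: dx_cmult differentiable_dx_ln)
qed

lemma laplacian_powr:
  "laplacian (\<lambda>y. u y powr q) x
     = u x powr q * (q / u x) * (\<Sum>i\<in>UNIV. dx i (dx i u) x + (q - 1) * (dx i u x)\<^sup>2 / u x)"
proof -
  have "dx i (dx i (\<lambda>y. u y powr q)) x
      = u x powr q * (q / u x) * (dx i (dx i u) x + (q - 1) * (dx i u x)\<^sup>2 / u x)" for i
    using u_pos[of x] unfolding dx_dx_powr dx_dx_ln unfolding dx_ln
    by (simp add: field_simps power2_eq_square)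
  then show ?thesis by (simp add: laplacian_def sum_distrib_left)
qed

lemma laplacian_eq_ln:
  "laplacian u x = u x * (\<Sum>i\<in>UNIV. dx i (dx i (\<lambda>y. ln (u y))) x + (dx i (\<lambda>y. ln (u y)) x)\<^sup>2)"
proof -
  have "dx i (dx i u) x = u x * (dx i (dx i (\<lambda>y. ln (u y))) x + (dx i (\<lambda>y. ln (u y)) x)\<^sup>2)" for i
    using u_pos[of x] by (simp add: dx_dx_ln power2_eq_square)
  then show ?thesis by (simp add: laplacian_def sum_distrib_left)
qed

end

text \<open>
  The heat inequality divided by \<open>u\<close>, expressed through \<open>f = u\<^bsup>1/q\<^esup>\<close>: since \<open>log u = q log f\<close>, one has
  \<open>\<Delta>u / u = \<Delta> log u + |\<nabla> log u|\<^sup>2 = q (\<Delta> log f + q |\<nabla> log f|\<^sup>2)\<close>.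
\<close>

lemma heat_inequality_ln:
  assumes u_pos: "\<And>x. u x > 0" and u_C2: "C2 u" and "q > 0" "d \<ge> \<sigma> * laplacian u x"
  shows "\<sigma> * (\<Sum>i\<in>UNIV. 1 / q * dx i (dx i (\<lambda>y. ln (u y))) x
      + q * (1 / q * dx i (\<lambda>y. ln (u y)) x * (1 / q * dx i (\<lambda>y. ln (u y)) x))) \<le> d / u x / q"
proof -
  have "(\<Sum>i\<in>UNIV. 1 / q * dx i (dx i (\<lambda>y. ln (u y))) x
      + q * (1 / q * dx i (\<lambda>y. ln (u y)) x * (1 / q * dx i (\<lambda>y. ln (u y)) x)))
     = (\<Sum>i\<in>UNIV. dx i (dx i (\<lambda>y. ln (u y))) x + (dx i (\<lambda>y. ln (u y)) x)\<^sup>2) / q"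
    using assms(3) by (simp add: sum_divide_distrib power2_eq_square field_simps)
  also have "\<dots> = laplacian u x / u x / q"
    using u_pos[of x] by (simp add: laplacian_eq_ln[OF u_pos u_C2])
  finally show ?thesis
    using divide_right_mono[OF divide_right_mono[OF assms(4)], of "u x" q] u_pos[of x] assms(3)
    by simp
qed

lemma deriv_powr_time:
  assumes "\<And>s. s > 0 \<Longrightarrow> w s > 0" "w C1_differentiable_on {0<..}" "t > 0"
  shows "deriv (\<lambda>s. w s powr q) t = w t powr q * (q * (deriv w t / w t))"
proof -
  have "w differentiable (at t)"
    using assms(2,3) by (auto simp: C1_differentiable_on_eq)
  then have "(w has_real_derivative deriv w t) (at t)"
    by (simp add: DERIV_deriv_iff_real_differentiable)
  from DERIV_chain2[OF DERIV_powr_base[OF assms(1)[OF assms(3)]] this]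
  show ?thesis by (simp add: DERIV_imp_deriv mult.assoc)
qed

text \<open>
  The matrix order contains symmetry, so a Hessian bound carries the symmetry of the second
  derivatives along with the inequality between quadratic forms.
\<close>

lemma matrix_ge_hessian_iff:
  "matrix_ge (hessian f x) (k *\<^sub>R mat 1) \<longleftrightarrow>
     (\<forall>i j. dx i (dx j f) x = dx j (dx i f) x) \<and>
     (\<forall>\<xi>. k * (\<xi> \<bullet> \<xi>) \<le> (\<Sum>i\<in>UNIV. \<Sum>j\<in>UNIV. \<xi> $ i * \<xi> $ j * dx i (dx j f) x))"
proof -
  have "transpose (hessian f x - k *\<^sub>R mat 1) = hessian f x - k *\<^sub>R mat 1 \<longleftrightarrow>
      (\<forall>i j. dx i (dx j f) x = dx j (dx i f) x)"
    by (simp add: vec_eq_iff transpose_def hessian_def mat_def) metis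
  moreover have "\<xi> \<bullet> ((hessian f x - k *\<^sub>R mat 1) *v \<xi>)
      = (\<Sum>i\<in>UNIV. \<Sum>j\<in>UNIV. \<xi> $ i * \<xi> $ j * dx i (dx j f) x) - k * (\<xi> \<bullet> \<xi>)" for \<xi>
  proof -
    have "\<xi> \<bullet> (hessian f x *v \<xi>) = (\<Sum>i\<in>UNIV. \<Sum>j\<in>UNIV. \<xi> $ i * \<xi> $ j * dx i (dx j f) x)"
      by (simp add: inner_vec_def matrix_vector_mult_def hessian_def sum_distrib_left ac_simps)
    then show ?thesis
      by (simp add: matrix_vector_mult_diff_rdistrib scaleR_matrix_vector_assoc[symmetric] inner_diff_right)
  qed
  ultimately show ?thesis by (simp add: matrix_ge_def pos_semidef_def)
qed

section \<open>Jensen's inequality for a quadratic form\<close>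

text \<open>
  The form is nonnegative at \<open>(X - r, Y - r)\<close>, where \<open>r\<close> is the common mean \<open>m / \<integral>K\<close>; integrating
  against \<open>K\<close> and expanding gives the inequality.
\<close>

lemma weighted_quadratic_jensen:
  fixes K X Y :: "'a \<Rightarrow> real"
  assumes K: "\<And>y. K y \<ge> 0" "integrable M K" "(\<integral>y. K y \<partial>M) > 0"
    and int1: "integrable M (\<lambda>y. K y * X y)" "integrable M (\<lambda>y. K y * Y y)"
    and int2: "integrable M (\<lambda>y. K y * (X y * X y))" "integrable M (\<lambda>y. K y * (X y * Y y))"
      "integrable M (\<lambda>y. K y * (Y y * Y y))"
    and mean: "(\<integral>y. K y * X y \<partial>M) = m" "(\<integral>y. K y * Y y \<partial>M) = m"
    and psd: "\<And>\<xi> \<eta>::real. 0 \<le> \<alpha> * \<xi>\<^sup>2 + 2 * \<beta> * (\<xi> * \<eta>) + \<gamma> * \<eta>\<^sup>2"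
  shows "(\<alpha> + 2 * \<beta> + \<gamma>) * m\<^sup>2 / (\<integral>y. K y \<partial>M)
     \<le> \<alpha> * (\<integral>y. K y * (X y * X y) \<partial>M) + 2 * \<beta> * (\<integral>y. K y * (X y * Y y) \<partial>M)
        + \<gamma> * (\<integral>y. K y * (Y y * Y y) \<partial>M)"
proof -
  define F where "F = (\<integral>y. K y \<partial>M)"
  define r where "r = m / F"
  have F: "F > 0" using K(3) by (simp add: F_def)
  have "0 \<le> (\<integral>y. K y * (\<alpha> * (X y - r)\<^sup>2 + 2 * \<beta> * ((X y - r) * (Y y - r)) + \<gamma> * (Y y - r)\<^sup>2) \<partial>M)"
    by (intro Bochner_Integration.integral_nonneg mult_nonneg_nonneg K(1) psd)
  also have "\<dots> = (\<integral>y. \<alpha> * (K y * (X y * X y)) + 2 * \<beta> * (K y * (X y * Y y)) + \<gamma> * (K y * (Y y * Y y))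
      - 2 * (\<alpha> + \<beta>) * r * (K y * X y) - 2 * (\<beta> + \<gamma>) * r * (K y * Y y)
      + (\<alpha> + 2 * \<beta> + \<gamma>) * r\<^sup>2 * K y \<partial>M)"
    by (intro Bochner_Integration.integral_cong refl) (simp add: power2_eq_square algebra_simps)
  also have "\<dots> = \<alpha> * (\<integral>y. K y * (X y * X y) \<partial>M) + 2 * \<beta> * (\<integral>y. K y * (X y * Y y) \<partial>M)
        + \<gamma> * (\<integral>y. K y * (Y y * Y y) \<partial>M) - 2 * (\<alpha> + \<beta>) * r * m - 2 * (\<beta> + \<gamma>) * r * m
        + (\<alpha> + 2 * \<beta> + \<gamma>) * r\<^sup>2 * F"
    using K(2) int1 int2 mean by (simp add: F_def)
  also have "\<dots> = \<alpha> * (\<integral>y. K y * (X y * X y) \<partial>M) + 2 * \<beta> * (\<integral>y. K y * (X y * Y y) \<partial>M)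
        + \<gamma> * (\<integral>y. K y * (Y y * Y y) \<partial>M) - (\<alpha> + 2 * \<beta> + \<gamma>) * m\<^sup>2 / F"
    using F by (simp add: r_def power2_eq_square field_simps)
  finally show ?thesis by (simp add: F_def)
qed

text \<open>A form with vanishing discriminant is the square of \<open>\<surd>\<alpha> \<xi> + \<surd>\<gamma> \<eta>\<close>.\<close>

lemma psd_rank_one:
  fixes \<alpha> \<beta> \<gamma> \<xi> \<eta> :: real
  assumes "\<alpha> \<ge> 0" "\<beta> \<ge> 0" "\<gamma> \<ge> 0" "\<beta>\<^sup>2 = \<alpha> * \<gamma>"
  shows "0 \<le> \<alpha> * \<xi>\<^sup>2 + 2 * \<beta> * (\<xi> * \<eta>) + \<gamma> * \<eta>\<^sup>2"
proof -
  have "\<beta> = sqrt \<alpha> * sqrt \<gamma>"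
    using assms by (metis real_sqrt_unique real_sqrt_mult)
  then have "\<alpha> * \<xi>\<^sup>2 + 2 * \<beta> * (\<xi> * \<eta>) + \<gamma> * \<eta>\<^sup>2 = (sqrt \<alpha> * \<xi> + sqrt \<gamma> * \<eta>)\<^sup>2"
    using assms by (simp add: power2_sum power_mult_distrib)
  then show ?thesis by simp
qed

section \<open>Derivatives of the convolution as weighted integrals\<close>

lemma conv_pos:
  assumes "\<And>x. f x > 0" "\<And>x. g x > 0" "conv_converges f g x"
  shows "conv f g x > 0"
proof -
  have "conv f g x \<noteq> 0"
  proof
    assume "conv f g x = 0"
    then have "AE y in lborel. f (x - y) * g y = 0"
      using assms integral_nonneg_eq_0_iff_AE[of lborel "\<lambda>y. f (x - y) * g y"]
      by (simp add: conv_def conv_converges_def less_imp_le)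
    then have "AE y in (lborel :: (real^'a) measure). False"
      using assms(1,2) by (simp add: less_imp_neq[symmetric])
    then show False by (simp add: ae_filter_eq_bot_iff eventually_False)
  qed
  moreover have "conv f g x \<ge> 0"
    unfolding conv_def using assms by (simp add: less_imp_le)
  ultimately show ?thesis by simp
qed

lemma weighted_double_sum:
  fixes X Y :: "'n::finite \<Rightarrow> 'a \<Rightarrow> real" and \<xi> :: "'n \<Rightarrow> real"
  assumes "\<And>i j. integrable M (\<lambda>y. K y * (X i y * Y j y))"
  shows "integrable M (\<lambda>y. K y * ((\<Sum>i\<in>UNIV. \<xi> i * X i y) * (\<Sum>j\<in>UNIV. \<xi> j * Y j y)))"
    and "(\<integral>y. K y * ((\<Sum>i\<in>UNIV. \<xi> i * X i y) * (\<Sum>j\<in>UNIV. \<xi> j * Y j y)) \<partial>M)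
      = (\<Sum>i\<in>UNIV. \<Sum>j\<in>UNIV. \<xi> i * \<xi> j * (\<integral>y. K y * (X i y * Y j y) \<partial>M))"
proof -
  have eq: "K y * ((\<Sum>i\<in>UNIV. \<xi> i * X i y) * (\<Sum>j\<in>UNIV. \<xi> j * Y j y))
      = (\<Sum>i\<in>UNIV. \<Sum>j\<in>UNIV. \<xi> i * \<xi> j * (K y * (X i y * Y j y)))" for y
    unfolding sum_product unfolding sum_distrib_left by (intro sum.cong refl) (simp add: ac_simps)
  show "integrable M (\<lambda>y. K y * ((\<Sum>i\<in>UNIV. \<xi> i * X i y) * (\<Sum>j\<in>UNIV. \<xi> j * Y j y)))"
    unfolding eq using assms by simp
  show "(\<integral>y. K y * ((\<Sum>i\<in>UNIV. \<xi> i * X i y) * (\<Sum>j\<in>UNIV. \<xi> j * Y j y)) \<partial>M)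
      = (\<Sum>i\<in>UNIV. \<Sum>j\<in>UNIV. \<xi> i * \<xi> j * (\<integral>y. K y * (X i y * Y j y) \<partial>M))"
    unfolding eq using assms by simp
qed

text \<open>
  The point \<open>(t, x)\<close> is fixed. The unnormalised density is \<open>K\<close>, and \<open>G1\<close>, \<open>H1\<close> and \<open>G2\<close>, \<open>H2\<close> are the
  gradient and Hessian of \<open>log f\<^sub>1\<close> and \<open>log f\<^sub>2\<close> at \<open>x - y\<close> and \<open>y\<close>, as functions of the integration
  variable \<open>y\<close>.
\<close>

locale regular_convolution =
  fixes p1 p2 :: real and u1 u2 :: "real \<Rightarrow> real^'n::finite \<Rightarrow> real" and t :: real and x :: "real^'n"
  assumes p_ge: "p1 \<ge> 1" "p2 \<ge> 1"
    and t_pos: "t > 0"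
    and u1_pos: "\<And>t x. t > 0 \<Longrightarrow> u1 t x > 0"
    and u2_pos: "\<And>t x. t > 0 \<Longrightarrow> u2 t x > 0"
    and regular: "technical_regularity p1 p2 u1 u2"
begin

definition K :: "real^'n \<Rightarrow> real" where
  "K y = root_fun p1 u1 t (x - y) * root_fun p2 u2 t y"

definition G1 :: "'n \<Rightarrow> real^'n \<Rightarrow> real" where
  "G1 i y = 1 / p1 * dx i (\<lambda>z. ln (u1 t z)) (x - y)"

definition G2 :: "'n \<Rightarrow> real^'n \<Rightarrow> real" where
  "G2 i y = 1 / p2 * dx i (\<lambda>z. ln (u2 t z)) y"

definition H1 :: "'n \<Rightarrow> 'n \<Rightarrow> real^'n \<Rightarrow> real" where
  "H1 i j y = 1 / p1 * dx i (dx j (\<lambda>z. ln (u1 t z))) (x - y)"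

definition H2 :: "'n \<Rightarrow> 'n \<Rightarrow> real^'n \<Rightarrow> real" where
  "H2 i j y = 1 / p2 * dx i (dx j (\<lambda>z. ln (u2 t z))) y"

definition F :: "real \<Rightarrow> real^'n \<Rightarrow> real" where
  "F s = conv (root_fun p1 u1 s) (root_fun p2 u2 s)"

abbreviation I :: "(real^'n \<Rightarrow> real) \<Rightarrow> real" where
  "I h \<equiv> (\<integral>y. K y * h y \<partial>lborel)"

abbreviation I_exists :: "(real^'n \<Rightarrow> real) \<Rightarrow> bool" where
  "I_exists h \<equiv> integrable lborel (\<lambda>y. K y * h y)"

lemma p_pos: "p1 > 0" "p2 > 0"
  using p_ge by auto

lemma u_C2: "C2 (u1 t)" "C2 (u2 t)"
  using regular t_pos by (auto simp: technical_regularity_def C12_def)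

lemma F_C2: "C2 (F t)"
  using regular t_pos by (auto simp: technical_regularity_def C12_def F_def)

lemma root_fun_alt: "root_fun q u s = (\<lambda>x. u s x powr (1 / q))"
  by (simp add: root_fun_def fun_eq_iff)

lemma dx_roots:
  "dx i (root_fun p1 u1 t) z = root_fun p1 u1 t z * (1 / p1 * dx i (\<lambda>z. ln (u1 t z)) z)"
  "dx i (root_fun p2 u2 t) z = root_fun p2 u2 t z * (1 / p2 * dx i (\<lambda>z. ln (u2 t z)) z)"
  unfolding root_fun_alt
  by (simp_all add: dx_powr[OF u1_pos[OF t_pos] u_C2(1)] dx_powr[OF u2_pos[OF t_pos] u_C2(2)])

lemma dx_dx_roots:
  "dx i (dx j (root_fun p1 u1 t)) z = root_fun p1 u1 t z *
     (1 / p1 * dx i (dx j (\<lambda>z. ln (u1 t z))) z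
      + (1 / p1 * dx i (\<lambda>z. ln (u1 t z)) z) * (1 / p1 * dx j (\<lambda>z. ln (u1 t z)) z))"
  "dx i (dx j (root_fun p2 u2 t)) z = root_fun p2 u2 t z *
     (1 / p2 * dx i (dx j (\<lambda>z. ln (u2 t z))) z
      + (1 / p2 * dx i (\<lambda>z. ln (u2 t z)) z) * (1 / p2 * dx j (\<lambda>z. ln (u2 t z)) z))"
  unfolding root_fun_alt
  by (simp_all only: dx_dx_powr[OF u1_pos[OF t_pos] u_C2(1)] dx_dx_powr[OF u2_pos[OF t_pos] u_C2(2)])

lemma dt_roots:
  "dt (root_fun p1 u1) t z = root_fun p1 u1 t z * (1 / p1 * (dt u1 t z / u1 t z))"
  "dt (root_fun p2 u2) t z = root_fun p2 u2 t z * (1 / p2 * (dt u2 t z / u2 t z))"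
  using deriv_powr_time[of "\<lambda>s. u1 s z" t "1 / p1"] deriv_powr_time[of "\<lambda>s. u2 s z" t "1 / p2"]
    u1_pos u2_pos t_pos regular
  by (simp_all add: dt_def root_fun_def technical_regularity_def C12_def)

lemma K_pos: "K y > 0"
  using u1_pos u2_pos t_pos by (simp add: K_def root_fun_def less_imp_neq[symmetric])

lemma conv_converges_roots: "conv_converges (root_fun p1 u1 t) (root_fun p2 u2 t) x"
  using regular t_pos by (simp add: technical_regularity_def)

lemma K_integrable: "integrable lborel K"
  using conv_converges_roots by (simp add: conv_converges_def K_def[abs_def])

lemma F_pos: "s > 0 \<Longrightarrow> F s z > 0"
  unfolding F_def using u1_pos u2_pos regular
  by (intro conv_pos) (auto simp: root_fun_def technical_regularity_def less_imp_neq[symmetric])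

lemma F_eq: "F t x = (\<integral>y. K y \<partial>lborel)"
  by (simp add: F_def conv_def K_def)

lemma expansion_converges:
  "h \<in> expansion_factors u1 t \<Longrightarrow> I_exists (\<lambda>y. h (x - y))"
  "h \<in> expansion_factors u2 t \<Longrightarrow> I_exists h"
  "I_exists (\<lambda>y. dx i (\<lambda>z. ln (u1 t z)) (x - y) * dx j (\<lambda>z. ln (u2 t z)) y)"
  using regular t_pos
  by (auto simp: technical_regularity_def expanded_integrals_converge_def conv_converges_def
      K_def ac_simps)

lemma integrable_factors:
  "I_exists (G1 i)" "I_exists (G2 i)"
  "I_exists (H1 i j)" "I_exists (H2 i j)"
  "I_exists (\<lambda>y. G1 i y * G1 j y)" "I_exists (\<lambda>y. G2 i y * G2 j y)"
  "I_exists (\<lambda>y. G1 i y * G2 j y)"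
  "I_exists (\<lambda>y. dt u1 t (x - y) / u1 t (x - y))" "I_exists (\<lambda>y. dt u2 t y / u2 t y)"
proof -
  have scale: "I_exists h \<Longrightarrow> I_exists (\<lambda>y. c * h y)" for h c
    using integrable_mult_right[of c lborel "\<lambda>y. K y * h y"] by (simp add: ac_simps)
  show "I_exists (G1 i)"
    unfolding G1_def by (intro scale expansion_converges(1)) (auto simp: expansion_factors_def)
  show "I_exists (G2 i)"
    unfolding G2_def by (intro scale expansion_converges(2)) (auto simp: expansion_factors_def)
  show "I_exists (H1 i j)"
    unfolding H1_def by (intro scale expansion_converges(1)) (auto simp: expansion_factors_def)
  show "I_exists (H2 i j)"
    unfolding H2_def by (intro scale expansion_converges(2)) (auto simp: expansion_factors_def)
  show "I_exists (\<lambda>y. dt u1 t (x - y) / u1 t (x - y))"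
    by (rule expansion_converges(1)[of "\<lambda>z. dt u1 t z / u1 t z"]) (simp add: expansion_factors_def)
  show "I_exists (\<lambda>y. dt u2 t y / u2 t y)"
    by (rule expansion_converges(2)) (simp add: expansion_factors_def)
  have "I_exists (\<lambda>y. dx i (\<lambda>z. ln (u1 t z)) (x - y) * dx j (\<lambda>z. ln (u1 t z)) (x - y))"
    by (rule expansion_converges(1)[of "\<lambda>z. dx i (\<lambda>z. ln (u1 t z)) z * dx j (\<lambda>z. ln (u1 t z)) z"])
      (auto simp: expansion_factors_def)
  from scale[OF this, of "1 / p1 * (1 / p1)"] show "I_exists (\<lambda>y. G1 i y * G1 j y)"
    by (simp add: G1_def ac_simps)
  have "I_exists (\<lambda>y. dx i (\<lambda>z. ln (u2 t z)) y * dx j (\<lambda>z. ln (u2 t z)) y)"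
    by (rule expansion_converges(2)) (auto simp: expansion_factors_def)
  from scale[OF this, of "1 / p2 * (1 / p2)"] show "I_exists (\<lambda>y. G2 i y * G2 j y)"
    by (simp add: G2_def ac_simps)
  from scale[OF expansion_converges(3), of "1 / p1 * (1 / p2)"]
  show "I_exists (\<lambda>y. G1 i y * G2 j y)"
    by (simp add: G1_def G2_def ac_simps)
qed

text \<open>
  The derivative may act on either factor of the convolution: both logarithmic gradients have the
  same mean.
\<close>

lemma dx_F: "dx i (F t) x = I (G1 i)" "dx i (F t) x = I (G2 i)"
proof -
  have "dx i (F t) x = conv (dx i (root_fun p1 u1 t)) (root_fun p2 u2 t) x"
    "dx i (F t) x = conv (root_fun p1 u1 t) (dx i (root_fun p2 u2 t)) x"
    using regular t_pos unfolding technical_regularity_def diff_under_integral_def F_def by metis+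
  then show "dx i (F t) x = I (G1 i)" "dx i (F t) x = I (G2 i)"
    by (simp_all add: conv_def dx_roots K_def G1_def G2_def ac_simps)
qed

text \<open>
  Two derivatives can act both on the first factor, one on each, or both on the second. The equality
  of the three results relates the second moments of \<open>G1\<close> and \<open>G2\<close> to the mean Hessians.
\<close>

lemma dx_dx_F:
  "dx i (dx j (F t)) x = I (H1 i j) + I (\<lambda>y. G1 i y * G1 j y)"
  "dx i (dx j (F t)) x = I (\<lambda>y. G1 i y * G2 j y)"
  "dx i (dx j (F t)) x = I (H2 i j) + I (\<lambda>y. G2 i y * G2 j y)"
proof -
  have "dx i (dx j (F t)) x = conv (dx i (dx j (root_fun p1 u1 t))) (root_fun p2 u2 t) x"
    using regular t_pos unfolding technical_regularity_def diff_under_integral_def F_def by metis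
  also have "\<dots> = (\<integral>y. K y * H1 i j y + K y * (G1 i y * G1 j y) \<partial>lborel)"
    unfolding conv_def
    by (intro Bochner_Integration.integral_cong refl)
      (simp add: dx_dx_roots K_def G1_def H1_def algebra_simps)
  finally show "dx i (dx j (F t)) x = I (H1 i j) + I (\<lambda>y. G1 i y * G1 j y)"
    by (simp add: integrable_factors)
  have "dx i (dx j (F t)) x = conv (root_fun p1 u1 t) (dx i (dx j (root_fun p2 u2 t))) x"
    using regular t_pos unfolding technical_regularity_def diff_under_integral_def F_def by metis
  also have "\<dots> = (\<integral>y. K y * H2 i j y + K y * (G2 i y * G2 j y) \<partial>lborel)"
    unfolding conv_def
    by (intro Bochner_Integration.integral_cong refl)
      (simp add: dx_dx_roots K_def G2_def H2_def algebra_simps)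
  finally show "dx i (dx j (F t)) x = I (H2 i j) + I (\<lambda>y. G2 i y * G2 j y)"
    by (simp add: integrable_factors)
  have "dx i (dx j (F t)) x = conv (dx i (root_fun p1 u1 t)) (dx j (root_fun p2 u2 t)) x"
    using regular t_pos unfolding technical_regularity_def diff_under_integral_def F_def by metis
  then show "dx i (dx j (F t)) x = I (\<lambda>y. G1 i y * G2 j y)"
    by (simp add: conv_def dx_roots K_def G1_def G2_def ac_simps)
qed

lemma dt_F:
  "dt F t x = I (\<lambda>y. dt u1 t (x - y) / u1 t (x - y)) / p1 + I (\<lambda>y. dt u2 t y / u2 t y) / p2"
proof -
  have "dt F t x = conv (dt (root_fun p1 u1) t) (root_fun p2 u2 t) x
      + conv (root_fun p1 u1 t) (dt (root_fun p2 u2) t) x"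
    using regular t_pos by (simp add: technical_regularity_def diff_under_integral_def F_def[abs_def])
  also have "conv (dt (root_fun p1 u1) t) (root_fun p2 u2 t) x
      = (\<integral>y. K y * (dt u1 t (x - y) / u1 t (x - y)) / p1 \<partial>lborel)"
    by (simp add: conv_def dt_roots K_def ac_simps)
  also have "conv (root_fun p1 u1 t) (dt (root_fun p2 u2) t) x
      = (\<integral>y. K y * (dt u2 t y / u2 t y) / p2 \<partial>lborel)"
    by (simp add: conv_def dt_roots K_def ac_simps)
  finally show ?thesis by (simp only: integral_divide_zero)
qed

section \<open>The heat inequality\<close>

text \<open>
  The heart of the first part, one coordinate at a time. Once \<open>dx_dx_F\<close> has replaced the integrals of
  \<open>H1\<close> and \<open>H2\<close> by second moments and the second derivative of \<open>F\<close>, that derivative is left with the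
  coefficient \<open>\<sigma>1 + \<sigma>2 - \<sigma>\<close>; being itself the mixed moment of \<open>G1\<close> and \<open>G2\<close>, it becomes the cross term
  of a quadratic form.
\<close>

lemma heat_coordinate:
  assumes p: "p > 0" "1 / p1 + 1 / p2 = 1 + 1 / p"
    and s: "\<sigma>1 \<ge> 0" "\<sigma>2 \<ge> 0"
    and rel: "\<sigma>1 * p1 * (1 - 1 / p2) = \<sigma>2 * p2 * (1 - 1 / p1)" "\<sigma> * p = \<sigma>1 * p1 + \<sigma>2 * p2"
  shows "\<sigma> * (dx i (dx i (F t)) x + (p - 1) * (dx i (F t) x)\<^sup>2 / F t x)
    \<le> \<sigma>1 * (I (H1 i i) + p1 * I (\<lambda>y. G1 i y * G1 i y))
      + \<sigma>2 * (I (H2 i i) + p2 * I (\<lambda>y. G2 i y * G2 i y))"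
proof -
  \<comment> \<open>\<open>\<beta>\<close> is the common value in the relation between \<open>\<sigma>1\<close> and \<open>\<sigma>2\<close>. Multiplying its two expressions
    gives the product of the diagonal coefficients; eliminating \<open>p\<close> from \<open>\<sigma>\<close> gives the cross term.\<close>
  define \<beta> where "\<beta> = \<sigma>1 * p1 * (1 - 1 / p2)"
  have "\<sigma> = (\<sigma>1 * p1 + \<sigma>2 * p2) * (1 / p)"
    using rel(2) p(1) by (simp add: field_simps)
  also have "1 / p = 1 / p1 + 1 / p2 - 1"
    using p(2) by simp
  also have "(\<sigma>1 * p1 + \<sigma>2 * p2) * (1 / p1 + 1 / p2 - 1)
      = \<sigma>1 + \<sigma>2 - \<sigma>1 * p1 * (1 - 1 / p2) - \<sigma>2 * p2 * (1 - 1 / p1)"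
    using p_pos by (simp add: field_simps)
  finally have cross: "2 * \<beta> = \<sigma>1 + \<sigma>2 - \<sigma>"
    using rel(1) by (simp add: \<beta>_def)
  have "\<beta>\<^sup>2 = (\<sigma>1 * p1 * (1 - 1 / p2)) * (\<sigma>2 * p2 * (1 - 1 / p1))"
    by (simp add: \<beta>_def power2_eq_square rel(1))
  also have "\<dots> = (\<sigma>1 * (p1 - 1)) * (\<sigma>2 * (p2 - 1))"
    using p_pos by (simp add: field_simps)
  finally have "\<beta>\<^sup>2 = (\<sigma>1 * (p1 - 1)) * (\<sigma>2 * (p2 - 1))" .
  then have psd: "0 \<le> \<sigma>1 * (p1 - 1) * \<xi>\<^sup>2 + 2 * \<beta> * (\<xi> * \<eta>) + \<sigma>2 * (p2 - 1) * \<eta>\<^sup>2" for \<xi> \<eta>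
    using s p_ge by (intro psd_rank_one) (auto simp: \<beta>_def)
  have "(\<sigma>1 * (p1 - 1) + 2 * \<beta> + \<sigma>2 * (p2 - 1)) * (dx i (F t) x)\<^sup>2 / F t x
     \<le> \<sigma>1 * (p1 - 1) * I (\<lambda>y. G1 i y * G1 i y) + 2 * \<beta> * I (\<lambda>y. G1 i y * G2 i y)
        + \<sigma>2 * (p2 - 1) * I (\<lambda>y. G2 i y * G2 i y)"
    unfolding F_eq
    by (rule weighted_quadratic_jensen)
      (use K_pos K_integrable integrable_factors dx_F[of i] psd F_pos[OF t_pos, of x] in
        \<open>auto simp: F_eq less_imp_le\<close>)
  also have "\<sigma>1 * (p1 - 1) + 2 * \<beta> + \<sigma>2 * (p2 - 1) = \<sigma> * (p - 1)"
    using cross rel(2) by (simp add: algebra_simps)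
  also have "I (\<lambda>y. G1 i y * G2 i y) = dx i (dx i (F t)) x"
    by (rule dx_dx_F(2)[symmetric])
  finally have jensen: "\<sigma> * (p - 1) * (dx i (F t) x)\<^sup>2 / F t x
     \<le> \<sigma>1 * (p1 - 1) * I (\<lambda>y. G1 i y * G1 i y) + (\<sigma>1 + \<sigma>2 - \<sigma>) * dx i (dx i (F t)) x
        + \<sigma>2 * (p2 - 1) * I (\<lambda>y. G2 i y * G2 i y)"
    unfolding cross .
  have H: "I (H1 i i) = dx i (dx i (F t)) x - I (\<lambda>y. G1 i y * G1 i y)"
    "I (H2 i i) = dx i (dx i (F t)) x - I (\<lambda>y. G2 i y * G2 i y)"
    using dx_dx_F(1,3)[of i i] by simp_all
  have "\<sigma> * (dx i (dx i (F t)) x + (p - 1) * (dx i (F t) x)\<^sup>2 / F t x)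
      = \<sigma> * dx i (dx i (F t)) x + \<sigma> * (p - 1) * (dx i (F t) x)\<^sup>2 / F t x"
    by (simp add: distrib_left)
  also note add_left_mono[OF jensen]
  also have "\<sigma> * dx i (dx i (F t)) x
      + (\<sigma>1 * (p1 - 1) * I (\<lambda>y. G1 i y * G1 i y) + (\<sigma>1 + \<sigma>2 - \<sigma>) * dx i (dx i (F t)) x
        + \<sigma>2 * (p2 - 1) * I (\<lambda>y. G2 i y * G2 i y))
      = \<sigma>1 * (I (H1 i i) + p1 * I (\<lambda>y. G1 i y * G1 i y))
        + \<sigma>2 * (I (H2 i i) + p2 * I (\<lambda>y. G2 i y * G2 i y))"
    unfolding H by (simp add: algebra_simps)
  finally show ?thesis .
qed

text \<open>
  Averages a pointwise lower bound on \<open>\<partial>\<^sub>t u\<^sub>j / u\<^sub>j\<close>, in the form provided by \<open>heat_inequality_ln\<close>,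
  against \<open>K\<close>.
\<close>

lemma integrated_heat:
  assumes "\<And>i. I_exists (H i)" "\<And>i. I_exists (\<lambda>y. G i y * G i y)" "I_exists d"
    and le: "\<And>y. \<tau> * (\<Sum>i\<in>UNIV. H i y + q * (G i y * G i y)) \<le> d y / q"
  shows "\<tau> * (\<Sum>i\<in>(UNIV :: 'n set). I (H i) + q * I (\<lambda>y. G i y * G i y)) \<le> I d / q"
proof -
  have eq: "K y * (\<tau> * (\<Sum>i\<in>UNIV. H i y + q * (G i y * G i y)))
     = (\<Sum>i\<in>UNIV. \<tau> * (K y * H i y) + \<tau> * q * (K y * (G i y * G i y)))" for y
    by (simp add: sum_distrib_left algebra_simps)
  have "\<tau> * (\<Sum>i\<in>UNIV. I (H i) + q * I (\<lambda>y. G i y * G i y))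
     = (\<integral>y. K y * (\<tau> * (\<Sum>i\<in>UNIV. H i y + q * (G i y * G i y))) \<partial>lborel)"
    unfolding eq by (simp add: assms(1,2) sum_distrib_left distrib_left mult.assoc)
  also have "\<dots> \<le> (\<integral>y. K y * d y / q \<partial>lborel)"
  proof (rule integral_mono)
    show "integrable lborel (\<lambda>y. K y * (\<tau> * (\<Sum>i\<in>UNIV. H i y + q * (G i y * G i y))))"
      unfolding eq by (simp add: assms(1,2))
    show "integrable lborel (\<lambda>y. K y * d y / q)"
      using assms(3) by (rule integrable_divide_zero)
    show "K y * (\<tau> * (\<Sum>i\<in>UNIV. H i y + q * (G i y * G i y))) \<le> K y * d y / q" for y
      using mult_left_mono[OF le[of y] less_imp_le[OF K_pos[of y]]] by simp
  qed
  finally show ?thesis by simp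
qed

text \<open>For \<open>F\<^sup>p\<close>, the heat inequality amounts to this one for \<open>F\<close>, multiplied by \<open>p F\<^bsup>p-1\<^esup>\<close>.\<close>

lemma F_heat:
  assumes p: "p > 0" "1 / p1 + 1 / p2 = 1 + 1 / p"
    and s: "\<sigma>1 \<ge> 0" "\<sigma>2 \<ge> 0"
    and rel: "\<sigma>1 * p1 * (1 - 1 / p2) = \<sigma>2 * p2 * (1 - 1 / p1)" "\<sigma> * p = \<sigma>1 * p1 + \<sigma>2 * p2"
    and heat: "\<And>z. dt u1 t z \<ge> \<sigma>1 * laplacian (u1 t) z" "\<And>z. dt u2 t z \<ge> \<sigma>2 * laplacian (u2 t) z"
  shows "\<sigma> * (\<Sum>i\<in>UNIV. dx i (dx i (F t)) x + (p - 1) * (dx i (F t) x)\<^sup>2 / F t x) \<le> dt F t x"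
proof -
  have 1: "\<sigma>1 * (\<Sum>i\<in>UNIV. I (H1 i i) + p1 * I (\<lambda>y. G1 i y * G1 i y))
      \<le> I (\<lambda>y. dt u1 t (x - y) / u1 t (x - y)) / p1"
  proof (rule integrated_heat)
    show "\<sigma>1 * (\<Sum>i\<in>UNIV. H1 i i y + p1 * (G1 i y * G1 i y)) \<le> dt u1 t (x - y) / u1 t (x - y) / p1" for y
      unfolding H1_def G1_def
      by (rule heat_inequality_ln[OF u1_pos[OF t_pos] u_C2(1) p_pos(1) heat(1)])
  qed (rule integrable_factors)+
  have 2: "\<sigma>2 * (\<Sum>i\<in>UNIV. I (H2 i i) + p2 * I (\<lambda>y. G2 i y * G2 i y))
      \<le> I (\<lambda>y. dt u2 t y / u2 t y) / p2"
  proof (rule integrated_heat)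
    show "\<sigma>2 * (\<Sum>i\<in>UNIV. H2 i i y + p2 * (G2 i y * G2 i y)) \<le> dt u2 t y / u2 t y / p2" for y
      unfolding H2_def G2_def
      by (rule heat_inequality_ln[OF u2_pos[OF t_pos] u_C2(2) p_pos(2) heat(2)])
  qed (rule integrable_factors)+
  have "\<sigma> * (\<Sum>i\<in>UNIV. dx i (dx i (F t)) x + (p - 1) * (dx i (F t) x)\<^sup>2 / F t x)
      \<le> (\<Sum>i\<in>UNIV. \<sigma>1 * (I (H1 i i) + p1 * I (\<lambda>y. G1 i y * G1 i y))
        + \<sigma>2 * (I (H2 i i) + p2 * I (\<lambda>y. G2 i y * G2 i y)))"
    unfolding sum_distrib_left by (intro sum_mono heat_coordinate p s rel)
  also have "\<dots> = \<sigma>1 * (\<Sum>i\<in>UNIV. I (H1 i i) + p1 * I (\<lambda>y. G1 i y * G1 i y))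
      + \<sigma>2 * (\<Sum>i\<in>UNIV. I (H2 i i) + p2 * I (\<lambda>y. G2 i y * G2 i y))"
    by (simp only: sum.distrib sum_distrib_left distrib_left)
  also have "\<dots> \<le> dt F t x"
    unfolding dt_F by (rule add_mono[OF 1 2])
  finally show ?thesis .
qed

lemma u_tilde_eq: "u_tilde p p1 p2 u1 u2 s = (\<lambda>z. F s z powr p)"
  by (simp add: u_tilde_def F_def fun_eq_iff)

lemma dt_u_tilde: "dt (u_tilde p p1 p2 u1 u2) t x = F t x powr p * (p * (dt F t x / F t x))"
proof -
  have "(\<lambda>s. F s x) C1_differentiable_on {0<..}"
    using regular by (simp add: technical_regularity_def C12_def F_def)
  from deriv_powr_time[OF F_pos this t_pos] show ?thesis
    by (simp add: dt_def u_tilde_eq)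
qed

lemma u_tilde_heat:
  assumes "p > 0" "1 / p1 + 1 / p2 = 1 + 1 / p"
    and "\<sigma>1 \<ge> 0" "\<sigma>2 \<ge> 0"
    and "\<sigma>1 * p1 * (1 - 1 / p2) = \<sigma>2 * p2 * (1 - 1 / p1)" "\<sigma> * p = \<sigma>1 * p1 + \<sigma>2 * p2"
    and "\<And>z. dt u1 t z \<ge> \<sigma>1 * laplacian (u1 t) z" "\<And>z. dt u2 t z \<ge> \<sigma>2 * laplacian (u2 t) z"
  shows "dt (u_tilde p p1 p2 u1 u2) t x \<ge> \<sigma> * laplacian (u_tilde p p1 p2 u1 u2 t) x"
proof -
  have "0 \<le> F t x powr p * (p / F t x)"
    using assms(1) F_pos[OF t_pos, of x] by simp
  from mult_left_mono[OF F_heat[OF assms] this]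
  show ?thesis
    unfolding dt_u_tilde unfolding u_tilde_eq laplacian_powr[OF F_pos[OF t_pos] F_C2]
    by (simp add: ac_simps)
qed

section \<open>The lower bound on the logarithmic Hessian\<close>

text \<open>
  By \<open>dx_dx_F\<close>, a lower bound on the Hessian of \<open>log u\<^sub>j\<close> is an upper bound on the second moment of the
  directional derivative of \<open>log f\<^sub>j\<close>, in terms of the second derivative \<open>D\<close> of \<open>F\<close> in direction \<open>\<xi>\<close>.
  The mixed moment is \<open>D\<close> itself. As \<open>\<theta> + \<mu> = 1\<close>, the second moment of \<open>\<theta> X + \<mu> Y\<close> is therefore at
  most \<open>D\<close> plus a multiple of \<open>F\<close>, and Jensen's inequality bounds it below by \<open>m\<^sup>2 / F\<close>, where \<open>m\<close> is the
  derivative of \<open>F\<close> in direction \<open>\<xi>\<close>. The difference \<open>D - m\<^sup>2 / F\<close> is \<open>F\<close> times the second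
  directional derivative of \<open>log F\<close>.
\<close>

lemma directional_hessian_bound:
  fixes \<xi> :: "real^'n"
  assumes split: "\<theta> + \<mu> = 1"
    and bound1: "\<And>z. k1 * (\<xi> \<bullet> \<xi>) \<le> (\<Sum>i\<in>UNIV. \<Sum>j\<in>UNIV. \<xi> $ i * \<xi> $ j * dx i (dx j (\<lambda>y. ln (u1 t y))) z)"
    and bound2: "\<And>z. k2 * (\<xi> \<bullet> \<xi>) \<le> (\<Sum>i\<in>UNIV. \<Sum>j\<in>UNIV. \<xi> $ i * \<xi> $ j * dx i (dx j (\<lambda>y. ln (u2 t y))) z)"
  shows "(\<theta>\<^sup>2 * k1 / p1 + \<mu>\<^sup>2 * k2 / p2) * (\<xi> \<bullet> \<xi>)
    \<le> (\<Sum>i\<in>UNIV. \<Sum>j\<in>UNIV. \<xi> $ i * \<xi> $ j * dx i (dx j (\<lambda>y. ln (F t y))) x)"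
proof -
  define S where "S a = (\<Sum>i\<in>UNIV. \<Sum>j\<in>UNIV. \<xi> $ i * \<xi> $ j * a i j)" for a :: "'n \<Rightarrow> 'n \<Rightarrow> real"
  have S_add: "S (\<lambda>i j. a i j + b i j) = S a + S b" for a b
    by (simp add: S_def sum.distrib algebra_simps)
  define D where "D = S (\<lambda>i j. dx i (dx j (F t)) x)"
  define m where "m = (\<Sum>i\<in>UNIV. \<xi> $ i * dx i (F t) x)"
  define X where "X y = (\<Sum>i\<in>UNIV. \<xi> $ i * G1 i y)" for y
  define Y where "Y y = (\<Sum>i\<in>UNIV. \<xi> $ i * G2 i y)" for y
  have F: "F t x > 0" by (rule F_pos[OF t_pos])
  have KS: "K y * S (\<lambda>i j. a i j y) = (\<Sum>i\<in>UNIV. \<Sum>j\<in>UNIV. \<xi> $ i * \<xi> $ j * (K y * a i j y))" for a y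
    by (simp add: S_def sum_distrib_left ac_simps)
  have quad: "I_exists (\<lambda>y. X y * X y)" "I (\<lambda>y. X y * X y) = S (\<lambda>i j. I (\<lambda>y. G1 i y * G1 j y))"
    "I_exists (\<lambda>y. Y y * Y y)" "I (\<lambda>y. Y y * Y y) = S (\<lambda>i j. I (\<lambda>y. G2 i y * G2 j y))"
    "I_exists (\<lambda>y. X y * Y y)" "I (\<lambda>y. X y * Y y) = S (\<lambda>i j. I (\<lambda>y. G1 i y * G2 j y))"
    unfolding X_def Y_def S_def
    by (rule weighted_double_sum[of lborel K, OF integrable_factors(5)]
             weighted_double_sum[of lborel K, OF integrable_factors(6)]
             weighted_double_sum[of lborel K, OF integrable_factors(7)])+
  have KX: "K y * X y = (\<Sum>i\<in>UNIV. \<xi> $ i * (K y * G1 i y))" for y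
    by (simp add: X_def sum_distrib_left ac_simps)
  have KY: "K y * Y y = (\<Sum>i\<in>UNIV. \<xi> $ i * (K y * G2 i y))" for y
    by (simp add: Y_def sum_distrib_left ac_simps)
  have lin: "I_exists X" "I X = m" "I_exists Y" "I Y = m"
    unfolding KX KY m_def
    by (simp_all add: integrable_factors dx_F(1)[symmetric])
       (simp_all add: integrable_factors dx_F(2)[symmetric])
  have KS_bound: "k * F t x \<le> S (\<lambda>i j. I (H i j))"
    if "\<And>i j. I_exists (H i j)" "\<And>y. k \<le> S (\<lambda>i j. H i j y)" for k H
  proof -
    have "(\<integral>y. K y * k \<partial>lborel) \<le> (\<integral>y. K y * S (\<lambda>i j. H i j y) \<partial>lborel)"
      using that(2)
      by (intro integral_mono mult_left_mono less_imp_le[OF K_pos])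
        (simp_all add: K_integrable KS that(1))
    also have "\<dots> = S (\<lambda>i j. I (H i j))"
      unfolding KS by (simp add: that(1) S_def)
    finally show ?thesis by (simp add: F_eq mult.commute)
  qed
  have D1: "I (\<lambda>y. X y * X y) \<le> D - k1 / p1 * (\<xi> \<bullet> \<xi>) * F t x"
  proof -
    have "k1 / p1 * (\<xi> \<bullet> \<xi>) \<le> S (\<lambda>i j. H1 i j y)" for y
      using divide_right_mono[OF bound1[of "x - y"], of p1] p_pos
      by (simp add: S_def H1_def sum_divide_distrib)
    from KS_bound[OF integrable_factors(3) this]
    have "k1 / p1 * (\<xi> \<bullet> \<xi>) * F t x \<le> S (\<lambda>i j. I (H1 i j))" .
    also have "\<dots> = D - I (\<lambda>y. X y * X y)"
      unfolding D_def dx_dx_F(1) S_add quad by simp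
    finally show ?thesis by simp
  qed
  have D2: "I (\<lambda>y. Y y * Y y) \<le> D - k2 / p2 * (\<xi> \<bullet> \<xi>) * F t x"
  proof -
    have "k2 / p2 * (\<xi> \<bullet> \<xi>) \<le> S (\<lambda>i j. H2 i j y)" for y
      using divide_right_mono[OF bound2[of y], of p2] p_pos
      by (simp add: S_def H2_def sum_divide_distrib)
    from KS_bound[OF integrable_factors(4) this]
    have "k2 / p2 * (\<xi> \<bullet> \<xi>) * F t x \<le> S (\<lambda>i j. I (H2 i j))" .
    also have "\<dots> = D - I (\<lambda>y. Y y * Y y)"
      unfolding D_def dx_dx_F(3) S_add quad by simp
    finally show ?thesis by simp
  qed
  have D12: "I (\<lambda>y. X y * Y y) = D"
    by (simp add: quad D_def dx_dx_F(2))
  have psd: "0 \<le> \<theta>\<^sup>2 * a\<^sup>2 + 2 * (\<theta> * \<mu>) * (a * b) + \<mu>\<^sup>2 * b\<^sup>2" for a b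
    using zero_le_power2[of "\<theta> * a + \<mu> * b"] by (simp add: power2_eq_square algebra_simps)
  have sq: "\<theta>\<^sup>2 + 2 * (\<theta> * \<mu>) + \<mu>\<^sup>2 = 1"
    using power2_sum[of \<theta> \<mu>] split by (simp add: algebra_simps)
  have "m\<^sup>2 / F t x \<le> \<theta>\<^sup>2 * I (\<lambda>y. X y * X y) + 2 * (\<theta> * \<mu>) * D + \<mu>\<^sup>2 * I (\<lambda>y. Y y * Y y)"
    using weighted_quadratic_jensen[where K = K and M = lborel and X = X and Y = Y and m = m,
        OF less_imp_le[OF K_pos] K_integrable _ lin(1,3) quad(1,5,3) lin(2,4) psd] F
    unfolding F_eq[symmetric] D12 sq by simp
  also have "\<dots> \<le> \<theta>\<^sup>2 * (D - k1 / p1 * (\<xi> \<bullet> \<xi>) * F t x) + 2 * (\<theta> * \<mu>) * D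
      + \<mu>\<^sup>2 * (D - k2 / p2 * (\<xi> \<bullet> \<xi>) * F t x)"
    using mult_left_mono[OF D1, of "\<theta>\<^sup>2"] mult_left_mono[OF D2, of "\<mu>\<^sup>2"] by simp
  also have "\<dots> = (\<theta>\<^sup>2 + 2 * (\<theta> * \<mu>) + \<mu>\<^sup>2) * D - (\<theta>\<^sup>2 * k1 / p1 + \<mu>\<^sup>2 * k2 / p2) * (\<xi> \<bullet> \<xi>) * F t x"
    by (simp add: algebra_simps)
  finally have "(\<theta>\<^sup>2 * k1 / p1 + \<mu>\<^sup>2 * k2 / p2) * (\<xi> \<bullet> \<xi>) * F t x \<le> D - m\<^sup>2 / F t x"
    by (simp add: sq)
  then have "(\<theta>\<^sup>2 * k1 / p1 + \<mu>\<^sup>2 * k2 / p2) * (\<xi> \<bullet> \<xi>) \<le> D / F t x - (m / F t x)\<^sup>2"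
    using F by (simp add: pos_le_divide_eq[symmetric] diff_divide_distrib power2_eq_square)
  also have "D / F t x - (m / F t x)\<^sup>2 = S (\<lambda>i j. dx i (dx j (\<lambda>y. ln (F t y))) x)"
    unfolding dx_dx_ln[OF F_pos[OF t_pos] F_C2] unfolding dx_ln[OF F_pos[OF t_pos] F_C2]
    by (simp add: D_def m_def S_def power2_eq_square sum_product sum_divide_distrib
        sum_subtractf[symmetric] algebra_simps)
  finally show ?thesis by (simp add: S_def)
qed

text \<open>
  Both derivatives are moved onto \<open>f\<^sub>1\<close>, so that the symmetry of the Hessian of \<open>log u\<^sub>1\<close>, which is part of
  a matrix lower bound on it, passes to \<open>F\<close>.
\<close>

lemma hessian_ln_F_symmetric:
  assumes "\<And>i j z. dx i (dx j (\<lambda>y. ln (u1 t y))) z = dx j (dx i (\<lambda>y. ln (u1 t y))) z"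
  shows "dx i (dx j (\<lambda>y. ln (F t y))) x = dx j (dx i (\<lambda>y. ln (F t y))) x"
proof -
  have "H1 i j = H1 j i" using assms by (simp add: H1_def fun_eq_iff)
  then show ?thesis
    by (simp add: dx_dx_ln[OF F_pos[OF t_pos] F_C2] dx_dx_F(1) mult.commute)
qed

lemma hessian_ln_u_tilde_bound:
  assumes p: "p > 0" and s: "\<sigma>1 > 0" "\<sigma>2 > 0"
    and rel: "\<sigma> * p = \<sigma>1 * p1 + \<sigma>2 * p2"
    and hess1: "\<And>z. matrix_ge (hessian (\<lambda>y. ln (u1 t y)) z) (- (1 / (2 * \<sigma>1 * t)) *\<^sub>R mat 1)"
    and hess2: "\<And>z. matrix_ge (hessian (\<lambda>y. ln (u2 t y)) z) (- (1 / (2 * \<sigma>2 * t)) *\<^sub>R mat 1)"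
  shows "matrix_ge (hessian (\<lambda>y. ln (u_tilde p p1 p2 u1 u2 t y)) x) (- (1 / (2 * \<sigma> * t)) *\<^sub>R mat 1)"
proof -
  define s where "s = \<sigma> * p"
  have s_pos: "s > 0"
    using s p_pos by (simp add: s_def rel add_pos_pos)
  then have \<sigma>_pos: "\<sigma> > 0"
    using p by (simp add: s_def zero_less_mult_iff)
  \<comment> \<open>These weights minimise \<open>\<theta>\<^sup>2 / (\<sigma>1 p1) + \<mu>\<^sup>2 / (\<sigma>2 p2)\<close> subject to \<open>\<theta> + \<mu> = 1\<close>; the minimum is
    \<open>1 / s\<close>.\<close>
  define \<theta> \<mu> where "\<theta> = \<sigma>1 * p1 / s" and "\<mu> = \<sigma>2 * p2 / s"
  have split: "\<theta> + \<mu> = 1"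
    using s_pos rel by (simp add: \<theta>_def \<mu>_def s_def add_divide_distrib[symmetric])
  have "\<theta>\<^sup>2 * (- (1 / (2 * \<sigma>1 * t))) / p1 + \<mu>\<^sup>2 * (- (1 / (2 * \<sigma>2 * t))) / p2
      = - ((\<sigma>1 * p1 + \<sigma>2 * p2) / (2 * s\<^sup>2 * t))"
    using s p_pos t_pos s_pos by (simp add: \<theta>_def \<mu>_def power2_eq_square field_simps)
  also have "\<dots> = - (1 / (2 * s * t))"
    using s_pos t_pos by (simp add: rel[symmetric] s_def[symmetric] power2_eq_square)
  finally have k: "p * (\<theta>\<^sup>2 * (- (1 / (2 * \<sigma>1 * t))) / p1 + \<mu>\<^sup>2 * (- (1 / (2 * \<sigma>2 * t))) / p2)
      = - (1 / (2 * \<sigma> * t))"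
    using p by (simp add: s_def)
  have ln_u_tilde: "dx i (dx j (\<lambda>y. ln (u_tilde p p1 p2 u1 u2 t y))) x
      = p * dx i (dx j (\<lambda>y. ln (F t y))) x" for i j
    unfolding u_tilde_eq by (rule dx_dx_ln_powr[OF F_pos[OF t_pos] F_C2])
  have sym: "dx i (dx j (\<lambda>y. ln (F t y))) x = dx j (dx i (\<lambda>y. ln (F t y))) x" for i j
    by (rule hessian_ln_F_symmetric) (use hess1 matrix_ge_hessian_iff in blast)
  have "- (1 / (2 * \<sigma> * t)) * (\<xi> \<bullet> \<xi>)
      \<le> (\<Sum>i\<in>UNIV. \<Sum>j\<in>UNIV. \<xi> $ i * \<xi> $ j * (p * dx i (dx j (\<lambda>y. ln (F t y))) x))" for \<xi> :: "real^'n"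
  proof -
    have "(\<theta>\<^sup>2 * (- (1 / (2 * \<sigma>1 * t))) / p1 + \<mu>\<^sup>2 * (- (1 / (2 * \<sigma>2 * t))) / p2) * (\<xi> \<bullet> \<xi>)
      \<le> (\<Sum>i\<in>UNIV. \<Sum>j\<in>UNIV. \<xi> $ i * \<xi> $ j * dx i (dx j (\<lambda>y. ln (F t y))) x)"
      using hess1 hess2 unfolding matrix_ge_hessian_iff
      by (intro directional_hessian_bound split) blast+
    from mult_left_mono[OF this, of p] p show ?thesis
      unfolding mult.assoc[symmetric, of p] k by (simp add: sum_distrib_left ac_simps)
  qed
  then show ?thesis
    unfolding matrix_ge_hessian_iff ln_u_tilde using sym by simp
qed

end

section \<open>Closure under convolution of powers\<close>

theorem theorem3p8:
  fixes u1 u2 :: "real \<Rightarrow> real^'n::finite \<Rightarrow> real"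
    and p p1 p2 \<sigma> \<sigma>1 \<sigma>2 :: real
  assumes "p1 \<ge> 1" and "p2 \<ge> 1" and "p > 0"
    and "1 / p1 + 1 / p2 = 1 + 1 / p"
    and "\<sigma> \<ge> 0" and "\<sigma>1 \<ge> 0" and "\<sigma>2 \<ge> 0"
    and "\<sigma>1 * p1 * (1 - 1 / p2) = \<sigma>2 * p2 * (1 - 1 / p1)"
    and "\<sigma> * p = \<sigma>1 * p1 + \<sigma>2 * p2"
    and "\<And>t x. t > 0 \<Longrightarrow> u1 t x > 0"
    and "\<And>t x. t > 0 \<Longrightarrow> u2 t x > 0"
    and "technical_regularity p1 p2 u1 u2"
  shows "((\<forall>t>0. \<forall>x. dt u1 t x \<ge> \<sigma>1 * laplacian (u1 t) x) \<and>
          (\<forall>t>0. \<forall>x. dt u2 t x \<ge> \<sigma>2 * laplacian (u2 t) x)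
          \<longrightarrow> (\<forall>t>0. \<forall>x. dt (u_tilde p p1 p2 u1 u2) t x
                  \<ge> \<sigma> * laplacian (u_tilde p p1 p2 u1 u2 t) x)) \<and>
         (\<sigma>1 > 0 \<and> \<sigma>2 > 0 \<and>
          (\<forall>t>0. \<forall>x. matrix_ge (hessian (\<lambda>y. ln (u1 t y)) x) (- (1 / (2 * \<sigma>1 * t)) *\<^sub>R mat 1)) \<and>
          (\<forall>t>0. \<forall>x. matrix_ge (hessian (\<lambda>y. ln (u2 t y)) x) (- (1 / (2 * \<sigma>2 * t)) *\<^sub>R mat 1))
          \<longrightarrow> (\<forall>t>0. \<forall>x. matrix_ge (hessian (\<lambda>y. ln (u_tilde p p1 p2 u1 u2 t y)) x)
                  (- (1 / (2 * \<sigma> * t)) *\<^sub>R mat 1)))"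
proof (intro conjI impI allI)
  fix t :: real and x
  assume "t > 0" and heat: "(\<forall>t>0. \<forall>x. dt u1 t x \<ge> \<sigma>1 * laplacian (u1 t) x) \<and>
    (\<forall>t>0. \<forall>x. dt u2 t x \<ge> \<sigma>2 * laplacian (u2 t) x)"
  then interpret regular_convolution p1 p2 u1 u2 t x
    using assms by unfold_locales auto
  show "dt (u_tilde p p1 p2 u1 u2) t x \<ge> \<sigma> * laplacian (u_tilde p p1 p2 u1 u2 t) x"
    using heat \<open>t > 0\<close> by (intro u_tilde_heat[OF assms(3,4,6,7,8,9)]) auto
next
  fix t :: real and x
  assume "t > 0" and hess: "\<sigma>1 > 0 \<and> \<sigma>2 > 0 \<and>
    (\<forall>t>0. \<forall>x. matrix_ge (hessian (\<lambda>y. ln (u1 t y)) x) (- (1 / (2 * \<sigma>1 * t)) *\<^sub>R mat 1)) \<and>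
    (\<forall>t>0. \<forall>x. matrix_ge (hessian (\<lambda>y. ln (u2 t y)) x) (- (1 / (2 * \<sigma>2 * t)) *\<^sub>R mat 1))"
  then interpret regular_convolution p1 p2 u1 u2 t x
    using assms by unfold_locales auto
  show "matrix_ge (hessian (\<lambda>y. ln (u_tilde p p1 p2 u1 u2 t y)) x) (- (1 / (2 * \<sigma> * t)) *\<^sub>R mat 1)"
    using hess \<open>t > 0\<close> assms by (intro hessian_ln_u_tilde_bound[of p \<sigma>1 \<sigma>2]) auto
qed

end
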